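(* Let $T$ be a tree. Then the following are equivalent: (1) $T$ is rayless, $V(T)$ is at most countable, and for every edge $\{x,y\}\in E(T)$ at least one of the degrees $\delta(x)$, $\delta(y)$ is finite; (2) there is a non-degenerate labeling $l_1\colon V(T)\to[0,\infty)$ for which the ultrametric space $(V(T), d_{l_1})$ is compact.
   Context: A tree is a connected acyclic graph with nonempty vertex set; $\delta(v)$ is the degree of $v$ (cardinality of the set of adjacent vertices). A ray is an infinite graph with pairwise distinct vertices $x_1,x_2,\ldots$ and edges $\{x_n,x_{n+1}\}$; a graph is rayless if it contains no ray. For a labeling $l\colon V(T)\to[0,\infty)$ define $d_l(u,u)=0$ and, for $u\neq v$, $d_l(u,v)=\max_{w\in V(P)} l(w)$, where $P$ is the unique path joining $u$ and $v$ in $T$. The labeling is non-degenerate if $\max\{l(u),l(v)\}>0$ for every edge $\{u,v\}$; then $d_l$ is an ultrametric. *)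

theory Defs
  imports "HOL-Analysis.Analysis"
begin

text \<open>A graph is a pair \<open>(V, E)\<close> with \<open>E\<close> a set of two-element subsets of \<open>V\<close>; \<open>V\<close> may be
  infinite.\<close>

definition simple_graph :: "'a set \<Rightarrow> 'a set set \<Rightarrow> bool" where
  "simple_graph V E \<longleftrightarrow> (\<forall>e\<in>E. e \<subseteq> V \<and> card e = 2)"

definition graph_path :: "'a set \<Rightarrow> 'a set set \<Rightarrow> 'a \<Rightarrow> 'a list \<Rightarrow> 'a \<Rightarrow> bool" where
  "graph_path V E u p v \<longleftrightarrow>
     p \<noteq> [] \<and> set p \<subseteq> V \<and> distinct p \<and> successively (\<lambda>x y. {x, y} \<in> E) p
     \<and> hd p = u \<and> last p = v"

definition graph_cycle :: "'a set \<Rightarrow> 'a set set \<Rightarrow> 'a list \<Rightarrow> bool" where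
  "graph_cycle V E c \<longleftrightarrow>
     3 \<le> length c \<and> set c \<subseteq> V \<and> distinct c \<and> successively (\<lambda>x y. {x, y} \<in> E) c
     \<and> {last c, hd c} \<in> E"

definition graph_connected :: "'a set \<Rightarrow> 'a set set \<Rightarrow> bool" where
  "graph_connected V E \<longleftrightarrow> (\<forall>u\<in>V. \<forall>v\<in>V. \<exists>p. graph_path V E u p v)"

definition graph_acyclic :: "'a set \<Rightarrow> 'a set set \<Rightarrow> bool" where
  "graph_acyclic V E \<longleftrightarrow> \<not> (\<exists>c. graph_cycle V E c)"

definition graph_tree :: "'a set \<Rightarrow> 'a set set \<Rightarrow> bool" where
  "graph_tree V E \<longleftrightarrow>
     simple_graph V E \<and> V \<noteq> {} \<and> graph_connected V E \<and> graph_acyclic V E"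

text \<open>The degree is a cardinal in general; only its finite values are told apart here, all infinite
  ones being \<open>\<infinity>\<close>.\<close>

definition vertex_degree :: "'a set \<Rightarrow> 'a set set \<Rightarrow> 'a \<Rightarrow> enat" where
  "vertex_degree V E v =
     (let N = {w\<in>V. {v, w} \<in> E} in if finite N then enat (card N) else \<infinity>)"

definition graph_ray :: "'a set \<Rightarrow> 'a set set \<Rightarrow> (nat \<Rightarrow> 'a) \<Rightarrow> bool" where
  "graph_ray V E x \<longleftrightarrow> inj x \<and> range x \<subseteq> V \<and> (\<forall>n. {x n, x (Suc n)} \<in> E)"

definition rayless :: "'a set \<Rightarrow> 'a set set \<Rightarrow> bool" where
  "rayless V E \<longleftrightarrow> \<not> (\<exists>x. graph_ray V E x)"

definition nondegenerate :: "'a set set \<Rightarrow> ('a \<Rightarrow> real) \<Rightarrow> bool" where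
  "nondegenerate E l \<longleftrightarrow> (\<forall>u v. {u, v} \<in> E \<longrightarrow> max (l u) (l v) > 0)"

text \<open>The value \<open>0\<close> outside \<open>V\<close> is there because the locale \<open>Metric_space\<close> requires
  non-negativity and symmetry on the whole type.\<close>

definition label_dist :: "'a set \<Rightarrow> 'a set set \<Rightarrow> ('a \<Rightarrow> real) \<Rightarrow> 'a \<Rightarrow> 'a \<Rightarrow> real" where
  "label_dist V E l u v =
     (if u \<in> V \<and> v \<in> V \<and> u \<noteq> v
      then Max (l ` set (THE p. graph_path V E u p v)) else 0)"


subsection \<open>Well-definedness: unique paths, and \<open>label_dist\<close> is an ultrametric\<close>

lemma graph_path_unique:
  assumes "graph_acyclic V E" "graph_path V E u p v" "graph_path V E u q v"
  shows "p = q"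
  using assms(2,3)
proof (induction p arbitrary: u q)
  case Nil
  then show ?case by (simp add: graph_path_def)
next
  case (Cons a p')
  have a: "a = u" using Cons.prems by (simp add: graph_path_def)
  obtain q' where q: "q = u # q'"
    using Cons.prems by (cases q) (auto simp: graph_path_def)
  show ?case
  proof (cases "p' = [] \<or> q' = []")
    case True
    then have "p' = [] \<and> q' = []"
      using Cons.prems unfolding q a graph_path_def by (auto split: if_splits)
    then show ?thesis by (simp add: q a)
  next
    case False
    then have ne: "p' \<noteq> []" "q' \<noteq> []" by auto
    have P: "set p' \<subseteq> V" "distinct p'" "successively (\<lambda>x y. {x, y} \<in> E) p'" "last p' = v"
      "{u, hd p'} \<in> E" "u \<notin> set p'" "u \<in> V"
      using Cons.prems(1) ne by (auto simp: graph_path_def a successively_Cons)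
    have Q: "set q' \<subseteq> V" "distinct q'" "successively (\<lambda>x y. {x, y} \<in> E) q'" "last q' = v"
      "{u, hd q'} \<in> E" "u \<notin> set q'"
      using Cons.prems(2) ne by (auto simp: graph_path_def q successively_Cons)
    show ?thesis
    proof (cases "hd p' = hd q'")
      case True
      have "p' = q'"
        by (rule Cons.IH[of "hd p'"]) (use P Q ne True in \<open>auto simp: graph_path_def\<close>)
      then show ?thesis by (simp add: q a)
    next
      case nhd: False
      have "\<exists>x\<in>set p'. x \<in> set q'"
        using ne P(4) Q(4) by (metis last_in_set)
      then obtain p1 x p2 where p1: "p' = p1 @ x # p2" "x \<in> set q'" "\<forall>y\<in>set p1. y \<notin> set q'"
        by (rule split_list_first_propE)
      obtain q1 q2 where q1: "q' = q1 @ x # q2" using p1(2) by (meson split_list)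
      let ?c = "u # p1 @ [x] @ rev q1"
      have sym: "successively (\<lambda>x y. {x, y} \<in> E) (rev q1)"
        using Q(3) by (auto simp: q1 successively_append_iff insert_commute)
      have "graph_cycle V E ?c"
        unfolding graph_cycle_def
      proof (intro conjI)
        show "3 \<le> length ?c" using nhd by (cases p1; cases q1) (auto simp: p1 q1)
        show "set ?c \<subseteq> V" using P Q by (auto simp: p1 q1)
        show "distinct ?c" using P Q p1(3) by (auto simp: p1(1) q1)
        show "{last ?c, hd ?c} \<in> E"
          using Q(5) by (cases q1) (auto simp: q1 insert_commute)
        have "successively (\<lambda>x y. {x, y} \<in> E) (p1 @ [x])"
          using P(3) by (auto simp: p1(1) successively_append_iff)
        moreover have "{x, hd (rev q1)} \<in> E" if "q1 \<noteq> []"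
          using Q(3) that by (auto simp: q1 successively_append_iff hd_rev insert_commute)
        moreover have "{u, hd (p1 @ [x])} \<in> E"
          using P(5) by (cases p1) (auto simp: p1(1))
        ultimately show "successively (\<lambda>x y. {x, y} \<in> E) ?c"
          using sym by (cases p1) (auto simp: successively_append_iff successively_Cons hd_append)
      qed
      then show ?thesis using assms(1) by (auto simp: graph_acyclic_def)
    qed
  qed
qed

lemma label_dist_eq:
  assumes "graph_acyclic V E" "graph_path V E u p v" "u \<noteq> v"
  shows "label_dist V E l u v = Max (l ` set p)"
proof -
  have "(THE p. graph_path V E u p v) = p"
    using graph_path_unique[OF assms(1)] assms(2) by blast
  moreover have "u \<in> V" "v \<in> V"
    using assms(2) unfolding graph_path_def by auto
  ultimately show ?thesis using assms(3) by (simp add: label_dist_def)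
qed

lemma graph_path_rev:
  assumes "graph_path V E u p v" shows "graph_path V E v (rev p) u"
  using assms by (auto simp: graph_path_def hd_rev last_rev insert_commute)

lemma graph_path_join:
  assumes "graph_path V E u p v" "graph_path V E v q w"
  obtains r where "graph_path V E u r w" "set r \<subseteq> set p \<union> set q"
proof -
  have "\<exists>x\<in>set p. x \<in> set q"
    using assms unfolding graph_path_def by (metis hd_in_set last_in_set)
  then obtain p1 x p2 where p1: "p = p1 @ x # p2" "x \<in> set q" "\<forall>y\<in>set p1. y \<notin> set q"
    by (rule split_list_first_propE)
  obtain q1 q2 where q1: "q = q1 @ x # q2" using p1(2) by (meson split_list)
  have "graph_path V E u (p1 @ x # q2) w"
    using assms p1(3) unfolding graph_path_def p1(1) q1
    by (auto simp: successively_append_iff hd_append)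
  then show thesis using that[of "p1 @ x # q2"] by (auto simp: p1(1) q1)
qed

lemma label_dist_pos:
  assumes "graph_tree V E" "nondegenerate E l" "u \<in> V" "v \<in> V" "u \<noteq> v"
  shows "label_dist V E l u v > 0"
proof -
  obtain p where p: "graph_path V E u p v"
    using assms by (auto simp: graph_tree_def graph_connected_def)
  obtain b r where b: "p = u # b # r"
    using p assms(5) unfolding graph_path_def by (cases p; cases "tl p") auto
  then have "max (l u) (l b) > 0"
    using p assms(2) by (auto simp: graph_path_def nondegenerate_def)
  moreover have "max (l u) (l b) \<le> Max (l ` set p)"
    by (intro max.boundedI Max_ge) (auto simp: b)
  ultimately show ?thesis
    using label_dist_eq[OF _ p assms(5), of l] assms(1) unfolding graph_tree_def by linarith
qed

lemma label_dist_commute: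
  assumes "graph_tree V E"
  shows "label_dist V E l u v = label_dist V E l v u"
proof (cases "u \<in> V \<and> v \<in> V \<and> u \<noteq> v")
  case True
  then obtain p where p: "graph_path V E u p v"
    using assms by (auto simp: graph_tree_def graph_connected_def)
  have ac: "graph_acyclic V E" using assms by (simp add: graph_tree_def)
  show ?thesis
    using label_dist_eq[OF ac p, of l] label_dist_eq[OF ac graph_path_rev[OF p], of l] True
    by (metis set_rev)
qed (auto simp: label_dist_def)

lemma label_dist_ultrametric:
  assumes "graph_tree V E" "nondegenerate E l" "u \<in> V" "v \<in> V" "w \<in> V"
  shows "label_dist V E l u w \<le> max (label_dist V E l u v) (label_dist V E l v w)"
proof (cases "u = v \<or> v = w \<or> u = w")
  case True
  have "0 \<le> label_dist V E l x y" if "x \<in> V" "y \<in> V" for x y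
    using label_dist_pos[OF assms(1,2) that] by (cases "x = y") (auto simp: label_dist_def)
  then show ?thesis
    using True assms(3-5) label_dist_def[of V E l w w] by (auto simp: le_max_iff_disj)
next
  case False
  have ac: "graph_acyclic V E" using assms by (simp add: graph_tree_def)
  obtain p q where p: "graph_path V E u p v" and q: "graph_path V E v q w"
    using assms unfolding graph_tree_def graph_connected_def by blast
  obtain r where r: "graph_path V E u r w" "set r \<subseteq> set p \<union> set q"
    using graph_path_join[OF p q] .
  have ne: "p \<noteq> []" "q \<noteq> []" "r \<noteq> []" using p q r by (auto simp: graph_path_def)
  have "Max (l ` set r) \<le> Max (l ` set p \<union> l ` set q)"
    by (rule Max_mono) (use r ne in auto)
  also have "\<dots> = max (Max (l ` set p)) (Max (l ` set q))"
    by (rule Max_Un) (use ne in auto)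
  finally show ?thesis
    using label_dist_eq[OF ac p, of l] label_dist_eq[OF ac q, of l] label_dist_eq[OF ac r(1), of l]
      False by auto
qed

lemma Metric_space_label_dist:
  assumes "graph_tree V E" "nondegenerate E l"
  shows "Metric_space V (label_dist V E l)"
proof
  show nn: "0 \<le> label_dist V E l x y" for x y
  proof (cases "x \<in> V \<and> y \<in> V \<and> x \<noteq> y")
    case True
    then show ?thesis using label_dist_pos[OF assms] by (simp add: less_imp_le)
  qed (auto simp: label_dist_def)
  show "label_dist V E l x y = label_dist V E l y x" for x y
    by (rule label_dist_commute[OF assms(1)])
  show "label_dist V E l x y = 0 \<longleftrightarrow> x = y" if "x \<in> V" "y \<in> V" for x y
    using label_dist_pos[OF assms that] that by (cases "x = y") (auto simp: label_dist_def)
  show "label_dist V E l x z \<le> label_dist V E l x y + label_dist V E l y z"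
    if "x \<in> V" "y \<in> V" "z \<in> V" for x y z
    using label_dist_ultrametric[OF assms that] nn[of x y] nn[of y z] by linarith
qed

end

theory Submission
  imports Defs
begin

text \<open>In a compact space an infinite set cannot have pairwise distances bounded away from \<open>0\<close>. Hence
  each set \<open>{l \<ge> c}\<close> with \<open>c > 0\<close> is finite, and a vertex of infinite degree has label \<open>0\<close>, since
  its neighbours are at least its label apart. This gives countability and the degree condition.
  A ray is excluded because the path from any candidate limit to a far vertex of the ray contains a
  fixed edge of the ray, and the label of one of its ends is positive.

  Conversely, label the vertices of infinite degree by \<open>0\<close> and the others by \<open>1/(n+1)\<close> along an
  enumeration. Given an infinite set \<open>S\<close> of vertices, a Koenig-type descent in the rooted tree
  stops, for lack of rays, at a vertex whose branch meets \<open>S\<close> in an infinite set although each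
  branch at a child meets \<open>S\<close> in a finite set. This vertex is an accumulation point of \<open>S\<close>, as only
  finitely many of these disjoint child branches contain a label exceeding a given \<open>\<epsilon> > 0\<close>.\<close>


subsection \<open>Paths and labels\<close>

lemma label_dist_ge:
  assumes "graph_tree V E" "graph_path V E u p v" "u \<noteq> v" "x \<in> set p"
  shows "l x \<le> label_dist V E l u v"
  using label_dist_eq[of V E u p v l] assms by (auto simp: graph_tree_def)

lemma label_dist_less:
  assumes "graph_tree V E" "graph_path V E u p v" "u \<noteq> v" "\<And>x. x \<in> set p \<Longrightarrow> l x < e"
  shows "label_dist V E l u v < e"
proof -
  have "p \<noteq> []" using assms(2) by (simp add: graph_path_def)
  then show ?thesis
    using label_dist_eq[of V E u p v l] assms by (auto simp: graph_tree_def)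
qed

lemma graph_path_ray:
  assumes "graph_ray V E x"
  shows "graph_path V E (x 0) (map x [0..<Suc n]) (x n)"
proof -
  have "successively (\<lambda>u v. {u, v} \<in> E) (map x [0..<Suc n])"
    using assms by (auto simp: successively_conv_nth graph_ray_def nth_append simp del: upt_Suc)
  moreover have "inj x" "range x \<subseteq> V"
    using assms by (auto simp: graph_ray_def)
  ultimately show ?thesis
    unfolding graph_path_def
    by (auto simp: distinct_map inj_on_def inj_def hd_map last_map hd_upt simp del: upt_Suc)
qed

lemma vertex_degree_eq_infinity:
  "vertex_degree V E v = \<infinity> \<longleftrightarrow> infinite {w \<in> V. {v, w} \<in> E}"
  by (simp add: vertex_degree_def Let_def)

lemma edge_endpoints:
  assumes "graph_tree V E" "{u, v} \<in> E"
  shows "u \<in> V" "v \<in> V" "u \<noteq> v"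
  using assms by (auto simp: graph_tree_def simple_graph_def dest!: bspec)


subsection \<open>Consequences of compactness\<close>

text \<open>An accumulation point \<open>p\<close> of \<open>S\<close> would have two distinct
  points of \<open>S\<close> within \<open>c/2\<close>, hence less than \<open>c\<close>
  apart.\<close>

lemma (in Metric_space) compact_space_separated_finite:
  assumes "compact_space mtopology" "S \<subseteq> M" "c > 0"
    and sep: "\<And>x y. x \<in> S \<Longrightarrow> y \<in> S \<Longrightarrow> x \<noteq> y \<Longrightarrow> c \<le> d x y"
  shows "finite S"
proof (rule ccontr)
  assume "infinite S"
  then obtain p where "p \<in> mtopology derived_set_of S"
    using assms compact_space_eq_Bolzano_Weierstrass by blast
  then have pM: "p \<in> M" and p: "\<And>r. r > 0 \<Longrightarrow> \<exists>y\<in>S. y \<noteq> p \<and> y \<in> mball p r"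
    by (auto simp: metric_derived_set_of)
  obtain y where y: "y \<in> S" "y \<noteq> p" "y \<in> M" "d p y < c/2"
    using p[of "c/2"] \<open>c > 0\<close> by auto
  then have "0 < d p y" using pM by simp
  \<comment> \<open>The radius \<open>d p y\<close> forces \<open>z\<close> to differ from
    \<open>y\<close>.\<close>
  then obtain z where z: "z \<in> S" "z \<noteq> p" "z \<in> M" "d p z < d p y"
    using p[of "d p y"] by auto
  have "d y z \<le> d p y + d p z"
    using triangle[of y p z] pM y z by (simp add: commute)
  then show False
    using sep[of y z] y z by auto
qed

locale compact_labeled_tree =
  fixes V :: "'a set" and E :: "'a set set" and l :: "'a \<Rightarrow> real"
  assumes tree: "graph_tree V E"
    and nondeg: "nondegenerate E l"
    and compact: "compact_space (Metric_space.mtopology V (label_dist V E l))"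
begin

sublocale Metric_space V "label_dist V E l"
  by (rule Metric_space_label_dist[OF tree nondeg])

lemma obtain_path:
  assumes "u \<in> V" "v \<in> V"
  obtains p where "graph_path V E u p v"
  using tree assms by (auto simp: graph_tree_def graph_connected_def)

text \<open>A path contains its ends, so two such vertices are at least \<open>c\<close>
  apart.\<close>

lemma finite_label_ge:
  assumes "c > 0"
  shows "finite {v \<in> V. c \<le> l v}"
proof (rule compact_space_separated_finite[OF compact _ assms])
  fix x y assume xy: "x \<in> {v \<in> V. c \<le> l v}" "y \<in> {v \<in> V. c \<le> l v}" "x \<noteq> y"
  then obtain p where p: "graph_path V E x p y"
    using obtain_path by blast
  then have "x \<in> set p" by (auto simp: graph_path_def)
  then show "c \<le> label_dist V E l x y"
    using label_dist_ge[OF tree p, of x l] xy by auto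
qed auto

lemma finite_neighbours:
  assumes "l v > 0"
  shows "finite {w \<in> V. {v, w} \<in> E}"
proof (rule compact_space_separated_finite[OF compact _ assms])
  fix x y assume xy: "x \<in> {w \<in> V. {v, w} \<in> E}" "y \<in> {w \<in> V. {v, w} \<in> E}" "x \<noteq> y"
  then have e: "{x, v} \<in> E" "{v, y} \<in> E" by (auto simp: insert_commute)
  then have "graph_path V E x [x, v, y] y"
    using xy edge_endpoints[OF tree e(1)] edge_endpoints[OF tree e(2)]
    by (auto simp: graph_path_def)
  then show "l v \<le> label_dist V E l x y"
    using label_dist_ge[OF tree, of x "[x, v, y]" y v l] xy by auto
qed auto

lemma finite_degree:
  assumes "{x, y} \<in> E"
  shows "vertex_degree V E x \<noteq> \<infinity> \<or> vertex_degree V E y \<noteq> \<infinity>"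
proof -
  have "0 < l x \<or> 0 < l y"
    using nondeg assms by (auto simp: nondegenerate_def less_max_iff_disj)
  then show ?thesis
    using finite_neighbours by (auto simp: vertex_degree_eq_infinity)
qed

lemma countable_vertices: "countable V"
proof -
  define P where "P = {v \<in> V. 0 < l v}"
  have "P = (\<Union>n. {v \<in> V. inverse (real (Suc n)) \<le> l v})"
  proof (intro equalityI subsetI)
    fix v assume "v \<in> P"
    then obtain n where "inverse (real (Suc n)) < l v"
      using reals_Archimedean by (auto simp: P_def)
    then show "v \<in> (\<Union>n. {v \<in> V. inverse (real (Suc n)) \<le> l v})"
      using \<open>v \<in> P\<close> by (auto simp: P_def intro: less_imp_le)
  next
    fix v assume "v \<in> (\<Union>n. {v \<in> V. inverse (real (Suc n)) \<le> l v})"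
    then obtain n where "v \<in> V" "inverse (real (Suc n)) \<le> l v" by blast
    moreover have "0 < inverse (real (Suc n))" by simp
    ultimately show "v \<in> P" unfolding P_def by (metis (lifting) less_le_trans mem_Collect_eq)
  qed
  moreover have "countable {v \<in> V. inverse (real (Suc n)) \<le> l v}" for n
    by (intro countable_finite finite_label_ge) simp
  ultimately have P: "countable P" by simp
  obtain v0 where v0: "v0 \<in> V" using tree by (auto simp: graph_tree_def)
  \<comment> \<open>The first edge on the path from \<open>v\<close> to \<open>v0\<close> has an end
    with positive label, so \<open>v\<close> lies in \<open>P\<close> or is one of the finitely many
    neighbours of a member of \<open>P\<close>.\<close>
  have "V \<subseteq> insert v0 (P \<union> (\<Union>b\<in>P. {w \<in> V. {b, w} \<in> E}))"
  proof
    fix v assume v: "v \<in> V"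
    show "v \<in> insert v0 (P \<union> (\<Union>b\<in>P. {w \<in> V. {b, w} \<in> E}))"
    proof (cases "v = v0")
      case False
      obtain p where p: "graph_path V E v p v0"
        using obtain_path v v0 by blast
      obtain b r where "p = v # b # r"
        using p False unfolding graph_path_def by (cases p; cases "tl p") auto
      then have b: "{v, b} \<in> E" "b \<in> V" using p by (auto simp: graph_path_def)
      then have "0 < l v \<or> 0 < l b"
        using nondeg by (auto simp: nondegenerate_def less_max_iff_disj)
      then show ?thesis using b v by (auto simp: P_def insert_commute)
    qed simp
  qed
  moreover have "countable {w \<in> V. {b, w} \<in> E}" if "b \<in> P" for b
    using that by (intro countable_finite finite_neighbours) (simp add: P_def)
  then have "countable (insert v0 (P \<union> (\<Union>b\<in>P. {w \<in> V. {b, w} \<in> E})))"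
    using P by (intro countable_insert countable_Un countable_UN)
  ultimately show ?thesis by (rule countable_subset)
qed

lemma ray_dist_ge:
  assumes ray: "graph_ray V E x" and p: "p \<in> V"
  obtains c m where "c > 0" "\<And>n. n > m \<Longrightarrow> c \<le> label_dist V E l p (x n)"
proof -
  have inj: "inj x" and xV: "\<And>n. x n \<in> V" and xE: "\<And>n. {x n, x (Suc n)} \<in> E"
    using ray by (auto simp: graph_ray_def)
  obtain q where q: "graph_path V E p q (x 0)"
    using obtain_path[OF p xV] .
  have "finite (x -` set q)"
    using inj by (simp add: finite_vimageI)
  then obtain m where m: "\<And>k. k \<in> x -` set q \<Longrightarrow> k < m"
    unfolding finite_nat_set_iff_bounded by blast
  \<comment> \<open>All indices at which the ray meets \<open>q\<close> are below \<open>m\<close>,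
    so this edge of the ray has both ends off \<open>q\<close>.\<close>
  define c where "c = max (l (x m)) (l (x (Suc m)))"
  have "c > 0"
    using nondeg xE[of m] unfolding nondegenerate_def c_def by blast
  moreover have "c \<le> label_dist V E l p (x n)" if n: "n > m" for n
  proof -
    obtain s where s: "graph_path V E p s (x n)"
      using obtain_path[OF p xV] .
    obtain t where t: "graph_path V E (x 0) t (x n)" "set t \<subseteq> set (rev q) \<union> set s"
      using graph_path_join[OF graph_path_rev[OF q] s] .
    \<comment> \<open>By uniqueness of paths, \<open>t\<close> runs along the ray and so through the
      chosen edge. Its ends avoid \<open>q\<close>, hence lie on \<open>s\<close>.\<close>
    have "t = map x [0..<Suc n]"
      using graph_path_unique[OF _ t(1) graph_path_ray[OF ray]] tree
      by (simp add: graph_tree_def)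
    then have "x m \<in> set t" "x (Suc m) \<in> set t" using n by (simp_all del: upt_Suc)
    moreover have "x m \<notin> set q" "x (Suc m) \<notin> set q"
      using m[of m] m[of "Suc m"] by auto
    ultimately have in_s: "x m \<in> set s" "x (Suc m) \<in> set s"
      using t(2) by auto
    have "p \<in> set q" using q by (auto simp: graph_path_def)
    then have "p \<noteq> x n" using m[of n] n by auto
    then show ?thesis
      unfolding c_def using label_dist_ge[OF tree s] in_s by simp
  qed
  ultimately show thesis by (rule that)
qed

lemma rayless: "rayless V E"
  unfolding rayless_def
proof
  assume "\<exists>x. graph_ray V E x"
  then obtain x where ray: "graph_ray V E x" ..
  then have "range x \<subseteq> V" by (simp add: graph_ray_def)
  then obtain p r where p: "p \<in> V" "strict_mono r" and lim: "limitin mtopology (x \<circ> r) p sequentially"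
    using compact unfolding compact_space_sequentially by blast
  obtain c m where c: "c > 0" "\<And>n. n > m \<Longrightarrow> c \<le> label_dist V E l p (x n)"
    using ray_dist_ge[OF ray p(1)] by blast
  have "\<forall>\<^sub>F n in sequentially. label_dist V E l (x (r n)) p < c"
  proof (rule eventually_mono)
    show "\<forall>\<^sub>F n in sequentially. (x \<circ> r) n \<in> V \<and> label_dist V E l ((x \<circ> r) n) p < c"
      using lim c(1) unfolding limitin_metric by blast
  qed simp
  then obtain N where N: "\<And>n. n \<ge> N \<Longrightarrow> label_dist V E l (x (r n)) p < c"
    by (auto simp: eventually_sequentially)
  \<comment> \<open>Since \<open>r n\<close> is at least \<open>n\<close>, the term
    \<open>Suc m\<close> pushes the index in the ray beyond \<open>m\<close>.\<close>
  define n where "n = max N (Suc m)"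
  have "r n > m" using seq_suble[OF p(2), of n] by (simp add: n_def)
  then show False
    using c(2)[of "r n"] N[of n] by (simp add: n_def commute)
qed

end


subsection \<open>Rooted trees\<close>

locale rooted_tree =
  fixes V :: "'a set" and E :: "'a set set" and r :: 'a
  assumes tree: "graph_tree V E" and root: "r \<in> V"
begin

definition root_path :: "'a \<Rightarrow> 'a list" where
  "root_path w = (THE p. graph_path V E r p w)"

text \<open>For \<open>v\<close> in \<open>V\<close> these are the descendants of \<open>v\<close>
  in the tree rooted at \<open>r\<close>, with \<open>v\<close> included.\<close>

definition branch :: "'a \<Rightarrow> 'a set" where
  "branch v = {w \<in> V. v \<in> set (root_path w)}"

text \<open>Stated through root paths instead of edges, so that the edge, the growth of depth and
  the disjointness of sibling branches can all be read off one equation.\<close>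

definition child :: "'a \<Rightarrow> 'a \<Rightarrow> bool" where
  "child v c \<longleftrightarrow> c \<in> V \<and> root_path c = root_path v @ [c]"

lemma root_path_eq:
  assumes "graph_path V E r p w"
  shows "root_path w = p"
  unfolding root_path_def using assms graph_path_unique tree
  by (metis (no_types, lifting) graph_tree_def the_equality)

lemma graph_path_root_path:
  assumes "w \<in> V"
  shows "graph_path V E r (root_path w) w"
proof -
  obtain p where "graph_path V E r p w"
    using tree root assms by (auto simp: graph_tree_def graph_connected_def)
  then show ?thesis using root_path_eq by simp
qed

text \<open>Initial segments of a path from the root are paths, and paths are unique.\<close>

lemma root_path_prefix:
  assumes "w \<in> V" "root_path w = a @ x # b"
  shows "root_path x = a @ [x]"
proof (rule root_path_eq)
  show "graph_path V E r (a @ [x]) x"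
    using graph_path_root_path[OF assms(1)] unfolding assms(2)
    by (auto simp: graph_path_def successively_append_iff hd_append)
qed

lemma branch_root: "branch r = V"
proof -
  have "r \<in> set (root_path w)" if "w \<in> V" for w
    using graph_path_root_path[OF that] hd_in_set[of "root_path w"] by (simp add: graph_path_def)
  then show ?thesis by (auto simp: branch_def)
qed

text \<open>The child is the vertex that follows \<open>v\<close> on the root path of
  \<open>w\<close>; the rest of that path stays below it.\<close>

lemma branch_childE:
  assumes "w \<in> branch v" "w \<noteq> v"
  obtains c p where "child v c" "w \<in> branch c" "graph_path V E v (v # p) w" "set p \<subseteq> branch c"
proof -
  have w: "w \<in> V" and "v \<in> set (root_path w)" using assms by (auto simp: branch_def)
  then obtain a p where ap: "root_path w = a @ v # p" by (meson split_list)
  have P: "graph_path V E r (a @ v # p) w" using graph_path_root_path[OF w] ap by simp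
  then have vp: "graph_path V E v (v # p) w"
    by (auto simp: graph_path_def successively_append_iff)
  then obtain c p' where p: "p = c # p'"
    using assms(2) by (cases p) (auto simp: graph_path_def)
  have "root_path c = (a @ [v]) @ [c]"
    using root_path_prefix[OF w, of "a @ [v]" c p'] ap p by simp
  moreover have "c \<in> V" using vp by (simp add: p graph_path_def)
  ultimately have "child v c"
    using root_path_prefix[OF w ap] by (simp add: child_def)
  moreover have "w \<in> branch c" using w ap p by (simp add: branch_def)
  moreover have "set p \<subseteq> branch c"
  proof
    fix x assume x: "x \<in> set p"
    then obtain b b' where b: "p = b @ x # b'" by (meson split_list)
    have "root_path x = (a @ v # b) @ [x]"
      using root_path_prefix[OF w, of "a @ v # b" x b'] ap b by simp
    \<comment> \<open>If \<open>b\<close> is empty, then \<open>x\<close> is \<open>c\<close>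
      itself.\<close>
    moreover have "c \<in> set (b @ [x])" using b p by (cases b) auto
    moreover have "x \<in> V" using x vp by (auto simp: graph_path_def)
    ultimately show "x \<in> branch c" by (auto simp: branch_def)
  qed
  ultimately show thesis using that vp by blast
qed

lemma root_path_branch:
  assumes "w \<in> branch v"
  obtains p where "root_path w = root_path v @ p"
proof -
  have w: "w \<in> V" and "v \<in> set (root_path w)" using assms by (auto simp: branch_def)
  then obtain a p where ap: "root_path w = a @ v # p" by (meson split_list)
  then show thesis using that root_path_prefix[OF w ap] by simp
qed

text \<open>The root path of \<open>w\<close> continues that of \<open>v\<close> by \<open>c\<close>
  as well as by \<open>c'\<close>.\<close>

lemma branch_child_disjoint:
  assumes "child v c" "child v c'" "w \<in> branch c" "w \<in> branch c'"
  shows "c = c'"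
proof -
  obtain p p' where "root_path w = root_path c @ p" "root_path w = root_path c' @ p'"
    using root_path_branch assms(3,4) by metis
  then show ?thesis using assms(1,2) by (simp add: child_def)
qed

lemma child_edge:
  assumes "v \<in> V" "child v c"
  shows "{v, c} \<in> E"
  using graph_path_root_path[of c] graph_path_root_path[of v] assms
  by (auto simp: child_def graph_path_def successively_append_iff)

text \<open>Depth grows strictly along the sequence, so no vertex repeats.\<close>

lemma graph_ray_children:
  assumes "x 0 \<in> V" and child: "\<And>n. child (x n) (x (Suc n))"
  shows "graph_ray V E x"
proof -
  have V: "x n \<in> V" for n
    using assms by (cases n) (auto simp: child_def)
  have "strict_mono (\<lambda>n. length (root_path (x n)))"
    using child by (simp add: strict_mono_Suc_iff child_def)
  then have "inj x"
    by (metis (mono_tags, lifting) injI strict_mono_eq)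
  then show ?thesis
    using V child_edge[OF V child] by (auto simp: graph_ray_def)
qed

lemma rayless_last_infinite_branch:
  assumes "rayless V E" "S \<subseteq> V" "infinite S"
  shows "\<exists>v\<in>V. infinite (branch v \<inter> S) \<and> (\<forall>c. child v c \<longrightarrow> finite (branch c \<inter> S))"
proof (rule ccontr)
  assume *: "\<not> ?thesis"
  then have step: "\<exists>c. (c \<in> V \<and> infinite (branch c \<inter> S)) \<and> child v c"
    if "v \<in> V \<and> infinite (branch v \<inter> S)" for v
    using that * by (meson child_def)
  have "r \<in> V \<and> infinite (branch r \<inter> S)"
    using root assms by (simp add: branch_root Int_absorb1)
  \<comment> \<open>If the descent never stopped, dependent choice would turn it into a ray.\<close>
  then have "\<exists>x. \<forall>n. (x n \<in> V \<and> infinite (branch (x n) \<inter> S)) \<and> child (x n) (x (Suc n))"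
    using step by (intro dependent_nat_choice) blast+
  then obtain x where "\<And>n. x n \<in> V" "\<And>n. child (x n) (x (Suc n))" by blast
  then have "graph_ray V E x" by (rule graph_ray_children)
  then show False using assms(1) by (auto simp: rayless_def)
qed

lemma branch_accumulation:
  assumes inf: "infinite (branch v \<inter> S)"
    and fin: "\<And>c. child v c \<Longrightarrow> finite (branch c \<inter> S)"
    and F: "finite F"
  obtains w p where "w \<in> S" "w \<in> V" "w \<noteq> v" "graph_path V E v (v # p) w" "set p \<inter> F = {}"
proof -
  \<comment> \<open>Disjointness of sibling branches embeds \<open>C\<close> into \<open>F\<close>.
    Discarding \<open>v\<close> and the finitely many finite sets \<open>branch c \<inter> S\<close>
    with \<open>c\<close> in \<open>C\<close> leaves a \<open>w\<close> in a child branch that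
    avoids \<open>F\<close>.\<close>
  define C where "C = {c. child v c \<and> branch c \<inter> F \<noteq> {}}"
  have "\<forall>c\<in>C. \<exists>f\<in>F. f \<in> branch c" by (auto simp: C_def)
  then obtain f where f: "\<And>c. c \<in> C \<Longrightarrow> f c \<in> F \<and> f c \<in> branch c" by metis
  then have "f ` C \<subseteq> F" by blast
  moreover have "inj_on f C"
  proof (rule inj_onI)
    fix c c' assume c: "c \<in> C" "c' \<in> C" "f c = f c'"
    then have "child v c" "child v c'" by (auto simp: C_def)
    then show "c = c'"
      using branch_child_disjoint f[OF c(1)] f[OF c(2)] c(3) by simp
  qed
  ultimately have "finite C" using F by (meson finite_imageD finite_subset)
  then have "finite (insert v (\<Union>c\<in>C. branch c \<inter> S))" (is "finite ?T")
    using fin by (intro finite.insertI finite_UN_I) (auto simp: C_def)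
  then have "\<not> branch v \<inter> S \<subseteq> ?T"
    using inf finite_subset by metis
  then obtain w where w: "w \<in> branch v" "w \<in> S" "w \<noteq> v" "\<And>c. c \<in> C \<Longrightarrow> w \<notin> branch c"
    by blast
  obtain c p where cp: "child v c" "w \<in> branch c" "graph_path V E v (v # p) w" "set p \<subseteq> branch c"
    using branch_childE[OF w(1,3)] by blast
  then have "c \<notin> C" using w by blast
  then have "set p \<inter> F = {}" using cp by (auto simp: C_def)
  moreover have "w \<in> V" using w(1) by (simp add: branch_def)
  ultimately show thesis using that w(2,3) cp(3) by blast
qed

text \<open>The branch at \<open>v\<close> consists of \<open>v\<close> and its child branches. This
  gives the accumulation point infinite degree, and thereby label \<open>0\<close>.\<close>

lemma infinite_children:
  assumes inf: "infinite (branch v \<inter> S)"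
    and fin: "\<And>c. child v c \<Longrightarrow> finite (branch c \<inter> S)"
  shows "infinite {c. child v c}"
proof
  assume "finite {c. child v c}"
  then have "finite (insert v (\<Union>c\<in>{c. child v c}. branch c \<inter> S))"
    using fin by (intro finite.insertI finite_UN_I) auto
  moreover have "branch v \<inter> S \<subseteq> insert v (\<Union>c\<in>{c. child v c}. branch c \<inter> S)"
  proof
    fix w assume w: "w \<in> branch v \<inter> S"
    show "w \<in> insert v (\<Union>c\<in>{c. child v c}. branch c \<inter> S)"
    proof (cases "w = v")
      case False
      then obtain c where "child v c" "w \<in> branch c"
        using branch_childE[of w v] w by (metis IntD1)
      then show ?thesis using w by blast
    qed simp
  qed
  ultimately show False using inf finite_subset by metis
qed

end


subsection \<open>Equivalence\<close>

lemma rayless_compact_label_dist: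
  fixes l :: "'a \<Rightarrow> real"
  assumes tree: "graph_tree V E" and "rayless V E" and nondeg: "nondegenerate E l"
    and label_zero: "\<And>v. v \<in> V \<Longrightarrow> vertex_degree V E v = \<infinity> \<Longrightarrow> l v = 0"
    and fin: "\<And>e. e > 0 \<Longrightarrow> finite {v \<in> V. e \<le> l v}"
  shows "compact_space (Metric_space.mtopology V (label_dist V E l))"
proof -
  interpret Metric_space V "label_dist V E l"
    by (rule Metric_space_label_dist[OF tree nondeg])
  obtain r where "r \<in> V" using tree by (auto simp: graph_tree_def)
  then interpret rooted_tree V E r using tree by unfold_locales
  show ?thesis
    unfolding compact_space_eq_Bolzano_Weierstrass
  proof (intro allI impI)
    fix S assume S: "S \<subseteq> V \<and> infinite S"
    obtain v where v: "v \<in> V" "infinite (branch v \<inter> S)" "\<And>c. child v c \<Longrightarrow> finite (branch c \<inter> S)"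
      using rayless_last_infinite_branch[OF assms(2)] S by metis
    have "{c. child v c} \<subseteq> {w \<in> V. {v, w} \<in> E}"
      using child_edge[OF v(1)] by (auto simp: child_def)
    then have "vertex_degree V E v = \<infinity>"
      using infinite_children[OF v(2,3)] by (metis finite_subset vertex_degree_eq_infinity)
    then have lv: "l v = 0" by (rule label_zero[OF v(1)])
    have "\<exists>w\<in>S. w \<noteq> v \<and> w \<in> mball v e" if e: "e > 0" for e
    proof -
      \<comment> \<open>With the vertices of label at least \<open>e\<close> as the avoided set,
        every label on \<open>p\<close> is below \<open>e\<close>; the remaining vertex
        \<open>v\<close> of the path has label \<open>0\<close>.\<close>
      obtain w p where w: "w \<in> S" "w \<in> V" "w \<noteq> v" "graph_path V E v (v # p) w"
          "set p \<inter> {v \<in> V. e \<le> l v} = {}"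
        using branch_accumulation[OF v(2,3) fin[OF e]] by metis
      have "set p \<subseteq> V" using w(4) by (simp add: graph_path_def)
      then have "label_dist V E l v w < e"
        using w lv e by (intro label_dist_less[OF tree w(4)]) auto
      then show ?thesis using w v(1) by auto
    qed
    then have "v \<in> mtopology derived_set_of S"
      using v(1) by (simp add: metric_derived_set_of)
    then show "mtopology derived_set_of S \<noteq> {}" by blast
  qed
qed

theorem theorem4p21:
  fixes V :: "'a set" and E :: "'a set set"
  assumes "graph_tree V E"
  shows "(rayless V E \<and> countable V
            \<and> (\<forall>x y. {x, y} \<in> E \<longrightarrow> vertex_degree V E x \<noteq> \<infinity> \<or> vertex_degree V E y \<noteq> \<infinity>))
    \<longleftrightarrow> (\<exists>l\<^sub>1 :: 'a \<Rightarrow> real. l\<^sub>1 \<in> V \<rightarrow> {0..} \<and> nondegenerate E l\<^sub>1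
            \<and> compact_space (Metric_space.mtopology V (label_dist V E l\<^sub>1)))"
  (is "?L \<longleftrightarrow> ?R")
proof
  assume L: ?L
  then obtain g :: "'a \<Rightarrow> nat" where g: "inj_on g V" by (auto simp: countable_def)
  \<comment> \<open>Injectivity of \<open>g\<close> leaves finitely many labels above any positive
    bound; \<open>Suc\<close> keeps the label positive where \<open>g v = 0\<close>, as
    \<open>inverse 0 = 0\<close>.\<close>
  define l :: "'a \<Rightarrow> real"
    where "l v = (if vertex_degree V E v = \<infinity> then 0 else inverse (real (Suc (g v))))" for v
  have "nondegenerate E l"
    unfolding nondegenerate_def
  proof (intro allI impI)
    fix u v assume "{u, v} \<in> E"
    then have "vertex_degree V E u \<noteq> \<infinity> \<or> vertex_degree V E v \<noteq> \<infinity>" using L by blast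
    then show "0 < max (l u) (l v)" by (auto simp: l_def less_max_iff_disj)
  qed
  moreover have "finite {v \<in> V. e \<le> l v}" if e: "e > 0" for e
  proof -
    obtain N where N: "inverse (real (Suc N)) < e"
      using reals_Archimedean[OF e] by blast
    have "g v \<le> N" if "e \<le> l v" for v
    proof (rule ccontr)
      assume "\<not> g v \<le> N"
      \<comment> \<open>The bound also covers infinite degree, where the label is
        \<open>0\<close>.\<close>
      then have "l v \<le> inverse (real (Suc N))"
        by (auto simp: l_def intro!: le_imp_inverse_le)
      then show False using N that by linarith
    qed
    then have "g ` {v \<in> V. e \<le> l v} \<subseteq> {..N}" by auto
    moreover have "inj_on g {v \<in> V. e \<le> l v}" using g by (rule inj_on_subset) auto
    ultimately show ?thesis by (meson finite_atMost finite_imageD finite_subset)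
  qed
  ultimately have "compact_space (Metric_space.mtopology V (label_dist V E l))"
    using L by (intro rayless_compact_label_dist assms) (auto simp: l_def)
  moreover have "l \<in> V \<rightarrow> {0..}" by (auto simp: l_def)
  ultimately show ?R using \<open>nondegenerate E l\<close> by blast
next
  assume ?R
  then obtain l where "compact_labeled_tree V E l"
    using assms by (auto simp: compact_labeled_tree_def)
  then interpret compact_labeled_tree V E l .
  show ?L using rayless countable_vertices finite_degree by blast
qed

end
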